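(* Let $p$ be a prime with $p \equiv 1 \pmod 4$. Let $A$ be a degenerate quadratic space over $\mathbb{Q}_p$ that is isometrically isomorphic to $\mathrm{diag}(0^{k}) \oplus S$, where $S$ is a nondegenerate quadratic space over $\mathbb{Q}_p$, and let $n$ be a positive integer. Then $A$ is embedded in $\mathrm{diag}(1^{n-1},\lambda)$ if and only if $S$ is embedded in $\mathrm{diag}(1^{n-2k-1},\lambda)$ (and $k \leq (n-2)/2$ when $n$ is even).
   Context: A quadratic space over $\mathbb{Q}_p$ is a finite-dimensional $\mathbb{Q}_p$-vector space with a (possibly degenerate) quadratic form. For $a_1,\dots,a_n \in \mathbb{Q}_p$, $\mathrm{diag}(a_1,\dots,a_n)$ denotes $\mathbb{Q}_p^n$ with the form $a_1x_1^2+\cdots+a_nx_n^2$; an entry $a^k$ means $a$ repeated $k$ times. So $\mathrm{diag}(0^k)$ is the $k$-dimensional space with zero form, and $\mathrm{diag}(1^{n-1},\lambda)$ is $(\mathbb{Q}_p^n, x_1^2+\cdots+x_{n-1}^2+\lambda x_n^2)$. $\oplus$ is the orthogonal direct sum. A quadratic space $(V,Q)$ is embedded in $(V',Q')$ if there is an injective linear map $f:V\to V'$ with $Q'(f(v))=Q(v)$ for all $v\in V$. $\lambda$ denotes a fixed nonsquare of $\mathbb{F}_p$, regarded in $\mathbb{Q}_p$ as a unit $\lambda\in\mathbb{Z}_p^\times$ whose reduction modulo $p$ is a nonsquare in $\mathbb{F}_p$. Since $A$ is degenerate, $k\ge1$. The zero space is allowed as $S$. The parenthetical condition is part of the right-hand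 side of the equivalence. If $n-2k-1<0$, "$S$ is embedded in $\mathrm{diag}(1^{n-2k-1},\lambda)$" is understood to be false. *)

theory Defs
  imports
    "Berlekamp_Zassenhaus.Finite_Field"
    "HOL-Computational_Algebra.Fraction_Field"
    "HOL-Computational_Algebra.Nth_Powers"
    "HOL-Library.Function_Algebras"
    "HOL-Library.Product_Plus"
begin

section \<open>The p-adic numbers\<close>

text \<open>
  The prime is the cardinality \<open>CARD('p)\<close> of a type of class \<^class>\<open>prime_card\<close>.  The ring of
  p-adic integers is the inverse limit of the rings of integers modulo \<open>p ^ n\<close>: the \<open>n\<close>-th
  component of a p-adic integer is its residue modulo \<open>p ^ n\<close>, represented in \<open>{0..<p ^ n}\<close>.
\<close>

typedef (overloaded) 'p padic_int =
  "{f :: nat \<Rightarrow> int. \<forall>n. f n \<in> {0..<int CARD('p::prime_card) ^ n} \<and>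
      f (Suc n) mod int CARD('p) ^ n = f n}"
  morphisms padic_component Abs_padic_int
proof -
  have "0 < int CARD('p)"
    using prime_card[where 'a = 'p] by (simp add: prime_gt_0_nat)
  then show ?thesis
    by (intro exI[of _ "\<lambda>_. 0"]) auto
qed

setup_lifting type_definition_padic_int

lemma CARD_prime_card_pos: "0 < int CARD('p::prime_card)"
  using prime_card[where 'a = 'p] by (simp add: prime_gt_0_nat)

lemma padic_component_mod:
  "padic_component x n mod int CARD('p::prime_card) ^ n = padic_component (x :: 'p padic_int) n"
  using padic_component[of x] by simp

lemma padic_component_Suc_mod:
  "padic_component (x :: 'p::prime_card padic_int) (Suc n) mod int CARD('p) ^ n
     = padic_component x n"
  using padic_component[of x] by simp

lemma padic_component_mod_le:
  assumes "m \<le> n"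
  shows "padic_component (x :: 'p::prime_card padic_int) n mod int CARD('p) ^ m
           = padic_component x m"
  using assms
proof (induction n rule: dec_induct)
  case base
  show ?case by (rule padic_component_mod)
next
  case (step n)
  have "padic_component x (Suc n) mod int CARD('p) ^ m
          = padic_component x (Suc n) mod int CARD('p) ^ n mod int CARD('p) ^ m"
    using step.hyps by (simp add: mod_mod_cancel le_imp_power_dvd)
  then show ?case
    using step.IH by (simp add: padic_component_Suc_mod)
qed

lemma padic_lift_aux:
  fixes f :: "nat \<Rightarrow> int"
  assumes "[f (Suc n) = f n] (mod int CARD('p::prime_card) ^ n)"
  shows "f n mod int CARD('p) ^ n \<in> {0..<int CARD('p) ^ n} \<and>
           f (Suc n) mod int CARD('p) ^ Suc n mod int CARD('p) ^ n = f n mod int CARD('p) ^ n"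
proof -
  have "f (Suc n) mod int CARD('p) ^ Suc n mod int CARD('p) ^ n = f (Suc n) mod int CARD('p) ^ n"
    by (intro mod_mod_cancel le_imp_power_dvd) simp
  then show ?thesis
    using assms CARD_prime_card_pos[where 'p = 'p] by (simp add: cong_def)
qed

instantiation padic_int :: (prime_card) comm_ring_1
begin

lift_definition zero_padic_int :: "'a padic_int" is "\<lambda>n. 0 mod int CARD('a) ^ n"
  by (rule padic_lift_aux) simp

lift_definition one_padic_int :: "'a padic_int" is "\<lambda>n. 1 mod int CARD('a) ^ n"
  by (rule padic_lift_aux) simp

lift_definition plus_padic_int :: "'a padic_int \<Rightarrow> 'a padic_int \<Rightarrow> 'a padic_int"
  is "\<lambda>f g n. (f n + g n) mod int CARD('a) ^ n"
  by (rule padic_lift_aux, rule cong_add; simp add: cong_def)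

lift_definition minus_padic_int :: "'a padic_int \<Rightarrow> 'a padic_int \<Rightarrow> 'a padic_int"
  is "\<lambda>f g n. (f n - g n) mod int CARD('a) ^ n"
  by (rule padic_lift_aux, rule cong_diff; simp add: cong_def)

lift_definition uminus_padic_int :: "'a padic_int \<Rightarrow> 'a padic_int"
  is "\<lambda>f n. (- f n) mod int CARD('a) ^ n"
  by (rule padic_lift_aux, rule cong_uminus; simp add: cong_def)

lift_definition times_padic_int :: "'a padic_int \<Rightarrow> 'a padic_int \<Rightarrow> 'a padic_int"
  is "\<lambda>f g n. (f n * g n) mod int CARD('a) ^ n"
  by (rule padic_lift_aux, rule cong_mult; simp add: cong_def)

instance
proof
  fix a b c :: "'a padic_int"
  show "a * b * c = a * (b * c)"
    by transfer (simp add: fun_eq_iff mod_simps mult_ac)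
  show "a * b = b * a"
    by transfer (simp add: fun_eq_iff mult_ac)
  show "1 * a = a"
    by transfer (auto simp: fun_eq_iff mod_simps)
  show "a + b + c = a + (b + c)"
    by transfer (simp add: fun_eq_iff mod_simps add_ac)
  show "a + b = b + a"
    by transfer (simp add: fun_eq_iff add_ac)
  show "0 + a = a"
    by transfer (auto simp: fun_eq_iff)
  show "- a + a = 0"
    by transfer (auto simp: fun_eq_iff mod_simps)
  show "a - b = a + - b"
    by transfer (auto simp: fun_eq_iff mod_simps)
  show "(a + b) * c = a * c + b * c"
    by transfer (auto simp: fun_eq_iff mod_simps algebra_simps)
  show "(0 :: 'a padic_int) \<noteq> 1"
  proof
    assume "(0 :: 'a padic_int) = 1"
    then have "(0 mod int CARD('a) ^ 1) = 1 mod int CARD('a) ^ 1"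
      by transfer (auto dest: fun_cong[where x = 1])
    then show False
      using prime_card[where 'a = 'a] by (simp add: prime_gt_Suc_0_nat)
  qed
qed

end

lemma padic_component_zero: "padic_component (0 :: 'p::prime_card padic_int) n = 0"
  by transfer simp

lemma padic_component_mult:
  "padic_component (x * y :: 'p::prime_card padic_int) n
     = padic_component x n * padic_component y n mod int CARD('p) ^ n"
  by transfer simp

lemma padic_component_eq_0_iff:
  assumes "m \<le> n"
  shows "padic_component (x :: 'p::prime_card padic_int) m = 0
           \<longleftrightarrow> int CARD('p) ^ m dvd padic_component x n"
  using padic_component_mod_le[OF assms, of x] by (simp add: dvd_eq_mod_eq_0)

lemma prime_power_dvd_mult:
  fixes p x y :: int
  assumes "prime p" "p ^ (a + b) dvd x * y"
  shows "p ^ a dvd x \<or> p ^ b dvd y"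
proof (cases "x = 0 \<or> y = 0")
  case False
  have "\<not> is_unit p" using assms(1) by auto
  with False assms show ?thesis
    by (auto simp: power_dvd_iff_le_multiplicity prime_elem_multiplicity_mult_distrib)
qed auto

instance padic_int :: (prime_card) idom
proof
  fix x y :: "'a padic_int"
  assume "x \<noteq> 0" "y \<noteq> 0"
  then obtain a b where ab: "padic_component x a \<noteq> 0" "padic_component y b \<noteq> 0"
    by (metis (no_types, lifting) ext padic_component_inject padic_component_zero)
  have "prime (int CARD('a))"
    using prime_card[where 'a = 'a] by simp
  show "x * y \<noteq> 0"
  proof
    assume "x * y = 0"
    then have "padic_component (x * y) (a + b) = 0"
      by (simp add: padic_component_zero)
    then have "int CARD('a) ^ (a + b) dvd padic_component x (a + b) * padic_component y (a + b)"
      by (simp add: padic_component_mult dvd_eq_mod_eq_0)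
    then show False
      using prime_power_dvd_mult[OF \<open>prime (int CARD('a))\<close>] ab
        padic_component_eq_0_iff[of a "a + b" x] padic_component_eq_0_iff[of b "a + b" y]
      by auto
  qed
qed

type_synonym 'p padic = "'p padic_int fract"

definition padic_of_int :: "'p::prime_card padic_int \<Rightarrow> 'p padic"
  where "padic_of_int x = Fract x 1"

definition padic_reduce :: "'p::prime_card padic_int \<Rightarrow> 'p mod_ring"
  where "padic_reduce x = of_int_mod_ring (padic_component x 1)"

lemma padic_reduce_1: "padic_reduce (1 :: 'p::prime_card padic_int) = 1"
  unfolding padic_reduce_def by transfer (auto simp: mod_simps)

lemma padic_reduce_add:
  "padic_reduce (x + y :: 'p::prime_card padic_int) = padic_reduce x + padic_reduce y"
  unfolding padic_reduce_def by (transfer, transfer) (simp add: mod_simps)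

lemma padic_reduce_mult:
  "padic_reduce (x * y :: 'p::prime_card padic_int) = padic_reduce x * padic_reduce y"
  unfolding padic_reduce_def by (transfer, transfer) (simp add: mod_simps)


section \<open>Quadratic spaces\<close>

text \<open>
  The underlying vector space is a subspace (the carrier) of an ambient vector space on a type;
  the quadratic form is only relevant on the carrier.  This way the dimension of a space may be a
  term rather than a type.
\<close>

record ('k, 'v) quad_space =
  qscale :: "'k \<Rightarrow> 'v \<Rightarrow> 'v"
  qcarrier :: "'v set"
  qform :: "'v \<Rightarrow> 'k"

text \<open>
  The polar form is twice the symmetric bilinear form \<open>b\<close> with \<open>Q v = b v v\<close>; the two have the
  same radical since 2 is invertible in the p-adic numbers.
\<close>

definition polar :: "('k::field, 'v::ab_group_add) quad_space \<Rightarrow> 'v \<Rightarrow> 'v \<Rightarrow> 'k"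
  where "polar X u v = qform X (u + v) - qform X u - qform X v"

definition quadratic_space :: "('k::field, 'v::ab_group_add) quad_space \<Rightarrow> bool"
  where "quadratic_space X \<longleftrightarrow>
    vector_space (qscale X) \<and>
    (\<exists>B. finite B \<and> qcarrier X = module.span (qscale X) B) \<and>
    (\<forall>c. \<forall>v\<in>qcarrier X. qform X (qscale X c v) = c\<^sup>2 * qform X v) \<and>
    (\<forall>u\<in>qcarrier X. \<forall>v\<in>qcarrier X. \<forall>w\<in>qcarrier X.
       polar X (u + v) w = polar X u w + polar X v w) \<and>
    (\<forall>c. \<forall>u\<in>qcarrier X. \<forall>v\<in>qcarrier X. polar X (qscale X c u) v = c * polar X u v)"

definition nondegenerate :: "('k::field, 'v::ab_group_add) quad_space \<Rightarrow> bool"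
  where "nondegenerate X \<longleftrightarrow>
    (\<forall>u\<in>qcarrier X. (\<forall>v\<in>qcarrier X. polar X u v = 0) \<longrightarrow> u = 0)"

definition degenerate :: "('k::field, 'v::ab_group_add) quad_space \<Rightarrow> bool"
  where "degenerate X \<longleftrightarrow> \<not> nondegenerate X"

definition qlinear ::
  "('k::field, 'v::ab_group_add) quad_space \<Rightarrow> ('k, 'w::ab_group_add) quad_space \<Rightarrow>
     ('v \<Rightarrow> 'w) \<Rightarrow> bool"
  where "qlinear X Y f \<longleftrightarrow>
    f ` qcarrier X \<subseteq> qcarrier Y \<and>
    (\<forall>u\<in>qcarrier X. \<forall>v\<in>qcarrier X. f (u + v) = f u + f v) \<and>
    (\<forall>c. \<forall>v\<in>qcarrier X. f (qscale X c v) = qscale Y c (f v))"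

definition qembedded ::
  "('k::field, 'v::ab_group_add) quad_space \<Rightarrow> ('k, 'w::ab_group_add) quad_space \<Rightarrow> bool"
  where "qembedded X Y \<longleftrightarrow>
    (\<exists>f. qlinear X Y f \<and> inj_on f (qcarrier X) \<and>
         (\<forall>v\<in>qcarrier X. qform Y (f v) = qform X v))"

definition qisometric ::
  "('k::field, 'v::ab_group_add) quad_space \<Rightarrow> ('k, 'w::ab_group_add) quad_space \<Rightarrow> bool"
  where "qisometric X Y \<longleftrightarrow>
    (\<exists>f. qlinear X Y f \<and> bij_betw f (qcarrier X) (qcarrier Y) \<and>
         (\<forall>v\<in>qcarrier X. qform Y (f v) = qform X v))"

definition qsum ::
  "('k::field, 'v::ab_group_add) quad_space \<Rightarrow> ('k, 'w::ab_group_add) quad_space \<Rightarrow>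
     ('k, 'v \<times> 'w) quad_space"  (infixr \<open>\<oplus>\<^sub>q\<close> 65)
  where "X \<oplus>\<^sub>q Y =
    \<lparr>qscale = (\<lambda>c (u, v). (qscale X c u, qscale Y c v)),
     qcarrier = qcarrier X \<times> qcarrier Y,
     qform = (\<lambda>(u, v). qform X u + qform Y v)\<rparr>"

text \<open>
  The coordinate space of dimension \<open>n\<close> consists of the sequences vanishing from index \<open>n\<close> on,
  with pointwise operations.
\<close>

definition qdiag :: "'k::field list \<Rightarrow> ('k, nat \<Rightarrow> 'k) quad_space"
  where "qdiag as =
    \<lparr>qscale = (\<lambda>c x i. c * x i),
     qcarrier = {x. \<forall>i\<ge>length as. x i = 0},
     qform = (\<lambda>x. \<Sum>i<length as. as ! i * (x i)\<^sup>2)\<rparr>"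

lemma vector_space_pointwise:
  "vector_space (\<lambda>(c::'k::field) (x::nat \<Rightarrow> 'k) i. c * x i)"
  by unfold_locales (auto simp: fun_eq_iff algebra_simps)

lemma quadratic_space_qdiag: "quadratic_space (qdiag (as :: 'k::field list))"
proof -
  let ?s = "\<lambda>(c::'k) (x::nat \<Rightarrow> 'k) i. c * x i"
  let ?n = "length as"
  define e :: "nat \<Rightarrow> nat \<Rightarrow> 'k" where "e j i = (if i = j then 1 else 0)" for i j
  interpret vector_space ?s by (rule vector_space_pointwise)
  have sum_apply: "(\<Sum>j\<in>A. g j) i = (\<Sum>j\<in>A. g j i)"
    for A :: "nat set" and g :: "nat \<Rightarrow> nat \<Rightarrow> 'k" and i
    by (induction A rule: infinite_finite_induct) auto
  have "{x. \<forall>i\<ge>?n. x i = 0} = span (e ` {..<?n})"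
  proof (intro equalityI subsetI)
    fix x :: "nat \<Rightarrow> 'k"
    assume "x \<in> {x. \<forall>i\<ge>?n. x i = 0}"
    then have "x = (\<Sum>j<?n. ?s (x j) (e j))"
      by (auto simp: fun_eq_iff sum_apply e_def if_distrib sum.delta' not_less cong: if_cong)
    moreover have "(\<Sum>j<?n. ?s (x j) (e j)) \<in> span (e ` {..<?n})"
      by (intro span_sum span_scale span_base) auto
    ultimately show "x \<in> span (e ` {..<?n})" by metis
  next
    fix x
    assume "x \<in> span (e ` {..<?n})"
    moreover have "subspace {x. \<forall>i\<ge>?n. x i = 0}"
      by (auto simp: subspace_def)
    moreover have "e ` {..<?n} \<subseteq> {x. \<forall>i\<ge>?n. x i = 0}"
      by (auto simp: e_def)
    ultimately show "x \<in> {x. \<forall>i\<ge>?n. x i = 0}"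
      using span_minimal by blast
  qed
  then have "\<exists>B. finite B \<and> {x. \<forall>i\<ge>?n. x i = 0} = span B"
    by (intro exI[of _ "e ` {..<?n}"]) simp
  moreover have polar: "polar (qdiag as) u v = (\<Sum>i<?n. 2 * as ! i * u i * v i)" for u v
    by (simp add: polar_def qdiag_def sum_subtractf[symmetric] power2_eq_square algebra_simps)
  ultimately show ?thesis
    using vector_space_pointwise[where 'k = 'k] unfolding quadratic_space_def polar
    by (simp add: qdiag_def sum_distrib_left power_mult_distrib algebra_simps sum.distrib)
qed

lemma quadratic_space_qsum:
  fixes X :: "('k::field, 'v::ab_group_add) quad_space"
    and Y :: "('k, 'w::ab_group_add) quad_space"
  assumes X: "quadratic_space X" and Y: "quadratic_space Y"
  shows "quadratic_space (X \<oplus>\<^sub>q Y)"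
proof -
  let ?s = "qscale (X \<oplus>\<^sub>q Y)"
  interpret vx: vector_space "qscale X" using X by (simp add: quadratic_space_def)
  interpret vy: vector_space "qscale Y" using Y by (simp add: quadratic_space_def)
  have s: "?s = (\<lambda>c (u, v). (qscale X c u, qscale Y c v))" by (simp add: qsum_def)
  interpret vs: vector_space ?s
    unfolding s by unfold_locales
      (auto simp: vx.scale_right_distrib vx.scale_left_distrib vy.scale_right_distrib
         vy.scale_left_distrib)
  obtain B C where B: "finite B" "qcarrier X = vx.span B" and C: "finite C" "qcarrier Y = vy.span C"
    using X Y by (auto simp: quadratic_space_def)
  let ?D = "(\<lambda>b. (b, 0)) ` B \<union> Pair 0 ` C"
  have "vx.span B \<times> vy.span C = vs.span ?D"
  proof (intro equalityI subsetI)
    fix z assume "z \<in> vx.span B \<times> vy.span C"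
    then obtain u v where z: "z = (u, v)" and u: "u \<in> vx.span B" and v: "v \<in> vy.span C" by auto
    have "(u, 0) \<in> vs.span ?D"
      using u
    proof (induction rule: vx.span_induct_alt)
      case base
      show ?case using vs.span_zero[of ?D] by (simp add: zero_prod_def)
    next
      case (step c b y)
      have "?s c (b, 0) + (y, 0) \<in> vs.span ?D"
        using step by (auto intro!: vs.span_add[OF vs.span_scale[OF vs.span_base]])
      then show ?case by (simp add: s)
    qed
    moreover have "(0, v) \<in> vs.span ?D"
      using v
    proof (induction rule: vy.span_induct_alt)
      case base
      show ?case using vs.span_zero[of ?D] by (simp add: zero_prod_def)
    next
      case (step c b y)
      have "?s c (0, b) + (0, y) \<in> vs.span ?D"
        using step by (auto intro!: vs.span_add[OF vs.span_scale[OF vs.span_base]])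
      then show ?case by (simp add: s)
    qed
    ultimately show "z \<in> vs.span ?D"
      using vs.span_add z by fastforce
  next
    fix z assume "z \<in> vs.span ?D"
    moreover have "vs.subspace (vx.span B \<times> vy.span C)"
      unfolding vs.subspace_def
      by (auto simp: s zero_prod_def vx.span_zero vy.span_zero vx.span_add
          vy.span_add vx.span_scale vy.span_scale)
    moreover have "?D \<subseteq> vx.span B \<times> vy.span C"
      by (auto simp: vx.span_base vy.span_base vx.span_zero vy.span_zero)
    ultimately show "z \<in> vx.span B \<times> vy.span C"
      using vs.span_minimal by blast
  qed
  then have "\<exists>D. finite D \<and> qcarrier (X \<oplus>\<^sub>q Y) = vs.span D"
    using B C by (intro exI[of _ ?D]) (simp add: qsum_def)
  moreover have polar: "polar (X \<oplus>\<^sub>q Y) u v = polar X (fst u) (fst v) + polar Y (snd u) (snd v)"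
    for u v
    by (simp add: polar_def qsum_def case_prod_beta)
  ultimately show ?thesis
    using X Y vs.vector_space_axioms unfolding quadratic_space_def polar
    by (auto simp: qsum_def algebra_simps)
qed

end

theory Submission
  imports Defs "HOL-Number_Theory.Euler_Criterion"
begin

text \<open>
  Over a field in which \<open>-1 = i\<^sup>2\<close> and \<open>2 \<noteq> 0\<close>, the plane \<open>diag(1,1)\<close> is hyperbolic: the vector
  \<open>e = (1, i)\<close> is isotropic.  The theorem follows from the equivalence
    \<open>0 \<oplus> Z\<close> embeds in \<open>diag(1,1) \<oplus> W\<close>  if and only if  \<open>Z\<close> embeds in \<open>W\<close>,
  for \<open>W\<close> a nondegenerate diagonal space, applied \<open>k\<close> times: each zero entry on the left uses up two
  entries \<open>1\<close> on the right.

  From right to left, the basis vector of the zero summand is sent to \<open>e\<close>.  From left to right, let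
  \<open>v\<close> be the image of that basis vector; it is a nonzero isotropic vector.  Isometries act
  transitively on the nonzero isotropic vectors of a nondegenerate space
  (\<open>isometries_transitive_on_isotropic\<close>, which is Witt's theorem for isotropic lines and is proved
  with at most two reflections), so \<open>v = e\<close> may be assumed.  As \<open>Z\<close> is orthogonal to the zero
  summand, it then lies in the orthogonal complement \<open>\<langle>e\<rangle> \<oplus> W\<close> of \<open>e\<close>, and the projection to \<open>W\<close>
  preserves the form and is injective on \<open>Z\<close>, because \<open>Z\<close> does not meet the line spanned by \<open>e\<close>.

  The process ends at \<open>diag(\<lambda>)\<close> or \<open>diag(1,\<lambda>)\<close>.  If \<open>\<lambda>\<close> is not a square, both are anisotropic and leave
  no room for a further zero entry; this is what forces \<open>2k + 1 \<le> n\<close>.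

  The arithmetic input is that \<open>-1\<close> is a square in \<open>\<rat>\<^sub>p\<close> when \<open>p \<equiv> 1\<close> modulo 4 (Euler's criterion and
  a Newton iteration) and that \<open>\<lambda>\<close> stays a nonsquare in \<open>\<rat>\<^sub>p\<close>: for fixed numerator and denominator,
  dividing out the powers of \<open>p\<close> turns a square root in \<open>\<rat>\<^sub>p\<close> into one in the field of \<open>p\<close> elements.
\<close>

section \<open>Isometric embeddings and polar forms\<close>

definition isometric_embedding ::
  "('k::field, 'v::ab_group_add) quad_space \<Rightarrow> ('k, 'w::ab_group_add) quad_space \<Rightarrow>
     ('v \<Rightarrow> 'w) \<Rightarrow> bool"
  where "isometric_embedding X Y f \<longleftrightarrow>
    qlinear X Y f \<and> inj_on f (qcarrier X) \<and> (\<forall>v\<in>qcarrier X. qform Y (f v) = qform X v)"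

lemma qembedded_iff_isometric_embedding:
  "qembedded X Y \<longleftrightarrow> (\<exists>f. isometric_embedding X Y f)"
  by (simp add: qembedded_def isometric_embedding_def)

lemma isometric_embedding_comp:
  assumes "isometric_embedding X Y f" "isometric_embedding Y Z g"
  shows "isometric_embedding X Z (g \<circ> f)"
proof -
  have f: "f v \<in> qcarrier Y" if "v \<in> qcarrier X" for v
    using assms(1) that unfolding isometric_embedding_def qlinear_def by blast
  have g: "g w \<in> qcarrier Z" if "w \<in> qcarrier Y" for w
    using assms(2) that unfolding isometric_embedding_def qlinear_def by blast
  have "inj_on g (f ` qcarrier X)" "inj_on f (qcarrier X)"
    using assms f unfolding isometric_embedding_def
    by (blast intro: inj_on_subset[of g "qcarrier Y"])+
  then have "inj_on (g \<circ> f) (qcarrier X)"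
    by (rule comp_inj_on[rotated])
  moreover have "qlinear X Z (g \<circ> f)"
    using assms f g by (simp add: isometric_embedding_def qlinear_def image_subset_iff)
  ultimately show ?thesis
    using assms f by (simp add: isometric_embedding_def)
qed

lemma qembedded_trans:
  assumes "qembedded X Y" "qembedded Y Z" shows "qembedded X Z"
proof -
  obtain f g where "isometric_embedding X Y f" "isometric_embedding Y Z g"
    using assms by (auto simp: qembedded_iff_isometric_embedding)
  then have "isometric_embedding X Z (g \<circ> f)"
    by (rule isometric_embedding_comp)
  then show ?thesis
    by (auto simp: qembedded_iff_isometric_embedding)
qed

context
  fixes X :: "('k::field, 'v::ab_group_add) quad_space"
  assumes X: "quadratic_space X"
begin

lemma vector_space_qscale: "vector_space (qscale X)"
  using X by (simp add: quadratic_space_def)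

lemma subspace_qcarrier: "module.subspace (qscale X) (qcarrier X)"
proof -
  interpret vector_space "qscale X" by (rule vector_space_qscale)
  show ?thesis using X subspace_span by (auto simp: quadratic_space_def)
qed

lemma qcarrier_zero: "0 \<in> qcarrier X"
  and qcarrier_add: "u \<in> qcarrier X \<Longrightarrow> v \<in> qcarrier X \<Longrightarrow> u + v \<in> qcarrier X"
  and qcarrier_scale: "u \<in> qcarrier X \<Longrightarrow> qscale X c u \<in> qcarrier X"
  and qcarrier_diff: "u \<in> qcarrier X \<Longrightarrow> v \<in> qcarrier X \<Longrightarrow> u - v \<in> qcarrier X"
proof -
  interpret vector_space "qscale X" by (rule vector_space_qscale)
  note s = subspace_qcarrier
  show "0 \<in> qcarrier X" using s by (rule subspace_0)
  show "u \<in> qcarrier X \<Longrightarrow> v \<in> qcarrier X \<Longrightarrow> u + v \<in> qcarrier X"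
    using s by (rule subspace_add)
  show "u \<in> qcarrier X \<Longrightarrow> qscale X c u \<in> qcarrier X" using s by (rule subspace_scale)
  show "u \<in> qcarrier X \<Longrightarrow> v \<in> qcarrier X \<Longrightarrow> u - v \<in> qcarrier X"
    using s by (rule subspace_diff)
qed

lemma qscale_minus_one: "qscale X (- 1) u = - u"
proof -
  interpret vector_space "qscale X" by (rule vector_space_qscale)
  show ?thesis by simp
qed

lemma polar_commute: "polar X u v = polar X v u"
  by (simp add: polar_def add.commute)

lemma qform_add: "qform X (u + v) = qform X u + qform X v + polar X u v"
  by (simp add: polar_def)

lemma qform_scale: "u \<in> qcarrier X \<Longrightarrow> qform X (qscale X c u) = c\<^sup>2 * qform X u"
  using X by (simp add: quadratic_space_def)

lemma polar_add_left:
  "\<lbrakk>u \<in> qcarrier X; v \<in> qcarrier X; w \<in> qcarrier X\<rbrakk>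
    \<Longrightarrow> polar X (u + v) w = polar X u w + polar X v w"
  using X by (simp add: quadratic_space_def)

lemma polar_add_right:
  "\<lbrakk>u \<in> qcarrier X; v \<in> qcarrier X; w \<in> qcarrier X\<rbrakk>
    \<Longrightarrow> polar X w (u + v) = polar X w u + polar X w v"
  using polar_add_left by (simp add: polar_commute)

lemma polar_scale_left:
  "\<lbrakk>u \<in> qcarrier X; v \<in> qcarrier X\<rbrakk> \<Longrightarrow> polar X (qscale X c u) v = c * polar X u v"
  using X by (simp add: quadratic_space_def)

lemma polar_scale_right:
  "\<lbrakk>u \<in> qcarrier X; v \<in> qcarrier X\<rbrakk> \<Longrightarrow> polar X v (qscale X c u) = c * polar X v u"
  using polar_scale_left by (simp add: polar_commute)

lemma diff_eq_add_scale: "u - v = u + qscale X (- 1) v"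
  by (simp add: qscale_minus_one)

lemma polar_diff_right:
  assumes "u \<in> qcarrier X" "v \<in> qcarrier X" "w \<in> qcarrier X"
  shows "polar X w (u - v) = polar X w u - polar X w v"
  using assms by (simp add: diff_eq_add_scale polar_add_right polar_scale_right qcarrier_scale)

lemma polar_diff_left:
  assumes "u \<in> qcarrier X" "v \<in> qcarrier X" "w \<in> qcarrier X"
  shows "polar X (u - v) w = polar X u w - polar X v w"
  using polar_diff_right[OF assms] by (simp add: polar_commute)

lemma qform_diff:
  assumes "u \<in> qcarrier X" "v \<in> qcarrier X"
  shows "qform X (u - v) = qform X u + qform X v - polar X u v"
  using assms by (simp add: diff_eq_add_scale qform_add qform_scale polar_scale_right qcarrier_scale)

lemma polar_self:
  assumes "u \<in> qcarrier X"
  shows "polar X u u = 2 * qform X u"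
proof -
  interpret vector_space "qscale X" by (rule vector_space_qscale)
  have "u + u = qscale X 2 u"
    using scale_left_distrib[of 1 1 u] by simp
  then have "qform X (u + u) = 4 * qform X u"
    using qform_scale[OF assms, of 2] by simp
  then show ?thesis by (simp add: polar_def)
qed

lemma qform_zero: "qform X 0 = 0"
proof -
  interpret vector_space "qscale X" by (rule vector_space_qscale)
  show ?thesis using qform_scale[OF qcarrier_zero, of 0] by simp
qed

section \<open>Reflections and isotropic vectors\<close>

definition reflection :: "'v \<Rightarrow> 'v \<Rightarrow> 'v"
  where "reflection d x = x - qscale X (polar X x d / qform X d) d"

text \<open>
  Since \<open>polar d d = 2 * qform d\<close>, the reflection negates the pairing with \<open>d\<close>.  Hence it is its own
  inverse, which gives injectivity.
\<close>

lemma isometric_embedding_reflection: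
  assumes d: "d \<in> qcarrier X" "qform X d \<noteq> 0"
  shows "isometric_embedding X X (reflection d)"
proof -
  interpret vector_space "qscale X" by (rule vector_space_qscale)
  have C: "reflection d x \<in> qcarrier X" if "x \<in> qcarrier X" for x
    using that d by (simp add: reflection_def qcarrier_diff qcarrier_scale)
  have "qlinear X X (reflection d)"
    using d C unfolding qlinear_def
    by (auto simp: reflection_def polar_add_left polar_scale_left add_divide_distrib
        scale_left_distrib scale_right_diff_distrib)
  moreover have "qform X (reflection d x) = qform X x" if "x \<in> qcarrier X" for x
    using that d
    by (simp add: reflection_def qform_diff qcarrier_scale qform_scale polar_scale_right
        power2_eq_square)
  moreover have "reflection d (reflection d x) = x" if x: "x \<in> qcarrier X" for x
  proof -
    have "polar X (reflection d x) d = - polar X x d"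
      using x d by (simp add: reflection_def polar_diff_left polar_scale_left qcarrier_scale polar_self)
    then show ?thesis by (simp add: reflection_def[of d "reflection d x"]) (simp add: reflection_def)
  qed
  then have "inj_on (reflection d) (qcarrier X)"
    by (rule inj_on_inverseI)
  ultimately show ?thesis by (simp add: isometric_embedding_def)
qed

text \<open>
  The reflection in \<open>u - v\<close> does it: the form takes the value \<open>- polar u v \<noteq> 0\<close> on \<open>u - v\<close>.
\<close>

lemma reflection_swaps_isotropic:
  assumes "u \<in> qcarrier X" "v \<in> qcarrier X" "qform X u = 0" "qform X v = 0" "polar X u v \<noteq> 0"
  shows "\<exists>\<sigma>. isometric_embedding X X \<sigma> \<and> \<sigma> u = v"
proof (intro exI conjI)
  interpret vector_space "qscale X" by (rule vector_space_qscale)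
  have q: "qform X (u - v) = - polar X u v"
    using assms by (simp add: qform_diff)
  then show "isometric_embedding X X (reflection (u - v))"
    using assms by (intro isometric_embedding_reflection) (auto simp: qcarrier_diff)
  have "polar X u (u - v) = - polar X u v"
    using assms by (simp add: polar_diff_right polar_self)
  then show "reflection (u - v) u = v"
    using q assms(5) by (simp add: reflection_def)
qed

text \<open>
  Every isotropic vector completes to a hyperbolic pair: a vector \<open>x\<close> not orthogonal to \<open>v\<close> is made
  isotropic by subtracting a multiple of \<open>v\<close>, which does not change \<open>polar v x\<close>.
\<close>

lemma isotropic_partner:
  assumes "nondegenerate X" "v \<in> qcarrier X" "v \<noteq> 0" "qform X v = 0"
  obtains v' where "v' \<in> qcarrier X" "qform X v' = 0" "polar X v v' \<noteq> 0"
proof -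
  obtain x where x: "x \<in> qcarrier X" "polar X v x \<noteq> 0"
    using assms(1-3) by (auto simp: nondegenerate_def)
  let ?v' = "x - qscale X (qform X x / polar X v x) v"
  have "qform X ?v' = 0"
    using x assms by (simp add: qform_diff qcarrier_scale qform_scale polar_scale_right polar_commute[of x v])
  moreover have "polar X v ?v' \<noteq> 0"
    using x assms by (simp add: polar_diff_right qcarrier_scale polar_scale_right polar_self)
  ultimately show ?thesis
    using that x assms by (meson qcarrier_diff qcarrier_scale)
qed

text \<open>
  If \<open>u\<close> and \<open>v\<close> are not orthogonal, one reflection suffices.  Otherwise two reflections do, through
  an isotropic vector \<open>w\<close> orthogonal to neither.  Such a \<open>w\<close> is found among hyperbolic partners \<open>u'\<close>
  of \<open>u\<close> and \<open>v'\<close> of \<open>v\<close>, or as a combination of both.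
\<close>

lemma isometries_transitive_on_isotropic:
  assumes nd: "nondegenerate X"
    and u: "u \<in> qcarrier X" "u \<noteq> 0" "qform X u = 0"
    and v: "v \<in> qcarrier X" "v \<noteq> 0" "qform X v = 0"
  shows "\<exists>\<sigma>. isometric_embedding X X \<sigma> \<and> \<sigma> u = v"
proof -
  have "\<exists>w\<in>qcarrier X. qform X w = 0 \<and> polar X u w \<noteq> 0 \<and> polar X w v \<noteq> 0"
    if uv: "polar X u v = 0"
  proof -
    obtain u' where u': "u' \<in> qcarrier X" "qform X u' = 0" "polar X u u' \<noteq> 0"
      using isotropic_partner[OF nd] u by blast
    obtain v' where v': "v' \<in> qcarrier X" "qform X v' = 0" "polar X v v' \<noteq> 0"
      using isotropic_partner[OF nd] v by blast
    show "\<exists>w\<in>qcarrier X. qform X w = 0 \<and> polar X u w \<noteq> 0 \<and> polar X w v \<noteq> 0"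
    proof (cases "polar X u' v = 0 \<and> polar X u v' = 0")
      case False
      then show ?thesis using u' v' by (metis polar_commute)
    next
      case True
      \<comment> \<open>adding a multiple of \<open>u\<close> makes \<open>u' + v'\<close> isotropic; as \<open>u\<close> is orthogonal to \<open>u\<close>, \<open>v'\<close> and
        \<open>v\<close>, the pairings with \<open>u\<close> and \<open>v\<close> remain those of \<open>u'\<close> and \<open>v'\<close>\<close>
      define w where "w = u' + v' - qscale X (polar X u' v' / polar X u u') u"
      have "w \<in> qcarrier X"
        unfolding w_def using u' v' u by (intro qcarrier_diff qcarrier_add qcarrier_scale)
      moreover have "qform X w = 0"
        using u' v' u True unfolding w_def
        by (simp add: qform_diff qcarrier_add qcarrier_scale qform_scale qform_add
            polar_scale_right polar_add_left polar_commute[of u' u] polar_commute[of v' u])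
      moreover have "polar X u w = polar X u u'"
        using u' v' u True unfolding w_def
        by (simp add: polar_diff_right polar_add_right polar_scale_right qcarrier_add
            qcarrier_scale polar_self)
      moreover have "polar X w v = polar X v v'"
        using u' v' u v uv True unfolding w_def
        by (simp add: polar_diff_left polar_add_left polar_scale_left qcarrier_add
            qcarrier_scale polar_commute[of v' v])
      ultimately show ?thesis using u'(3) v'(3) by metis
    qed
  qed
  then consider "polar X u v \<noteq> 0"
    | w where "w \<in> qcarrier X" "qform X w = 0" "polar X u w \<noteq> 0" "polar X w v \<noteq> 0"
    by blast
  then show ?thesis
  proof cases
    case 1
    then show ?thesis using reflection_swaps_isotropic u v by blast
  next
    case (2 w)
    obtain \<sigma> where \<sigma>: "isometric_embedding X X \<sigma>" "\<sigma> u = w"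
      using reflection_swaps_isotropic u 2 by blast
    obtain \<tau> where \<tau>: "isometric_embedding X X \<tau>" "\<tau> w = v"
      using reflection_swaps_isotropic v 2 by blast
    show ?thesis
      using isometric_embedding_comp[OF \<sigma>(1) \<tau>(1)] \<sigma>(2) \<tau>(2) by (intro exI[of _ "\<tau> \<circ> \<sigma>"]) simp
  qed
qed

end

section \<open>Diagonal forms and embeddings of isometric spaces\<close>

lemma isometric_embedding_zero:
  assumes "quadratic_space X" "isometric_embedding X Y f"
  shows "f 0 = 0"
proof -
  have "f (0 + 0) = f 0 + f 0"
    using assms qcarrier_zero unfolding isometric_embedding_def qlinear_def by blast
  then show ?thesis by simp
qed

lemma qisometric_imp_qembedded: "qisometric X Y \<Longrightarrow> qembedded X Y"
  unfolding qisometric_def qembedded_def bij_betw_def by blast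

lemma qisometric_imp_qembedded_converse:
  assumes X: "quadratic_space X" and "qisometric X Y"
  shows "qembedded Y X"
proof -
  obtain f where f: "qlinear X Y f" "bij_betw f (qcarrier X) (qcarrier Y)"
      "\<And>v. v \<in> qcarrier X \<Longrightarrow> qform Y (f v) = qform X v"
    using assms by (auto simp: qisometric_def)
  define g where "g = inv_into (qcarrier X) f"
  have bg: "bij_betw g (qcarrier Y) (qcarrier X)"
    unfolding g_def by (rule bij_betw_inv_into[OF f(2)])
  have gC: "g y \<in> qcarrier X" if "y \<in> qcarrier Y" for y
    using bg that bij_betwE by blast
  have fg: "f (g y) = y" if "y \<in> qcarrier Y" for y
    unfolding g_def by (rule bij_betw_inv_into_right[OF f(2) that])
  have gf: "g (f x) = x" if "x \<in> qcarrier X" for x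
    unfolding g_def by (rule bij_betw_inv_into_left[OF f(2) that])
  have "g (u + v) = g u + g v" if "u \<in> qcarrier Y" "v \<in> qcarrier Y" for u v
    using gf[of "g u + g v"] f(1) qcarrier_add[OF X gC gC, OF that] gC that fg
    by (simp add: qlinear_def)
  moreover have "g (qscale Y c u) = qscale X c (g u)" if "u \<in> qcarrier Y" for c u
    using gf[of "qscale X c (g u)"] f(1) qcarrier_scale[OF X gC, OF that] gC that fg
    by (simp add: qlinear_def)
  ultimately have "qlinear Y X g"
    using gC by (auto simp: qlinear_def)
  moreover have "qform X (g y) = qform Y y" if "y \<in> qcarrier Y" for y
    using f(3)[OF gC] fg that by metis
  ultimately show ?thesis
    using bg unfolding qembedded_def bij_betw_def by blast
qed

lemma polar_qdiag: "polar (qdiag as) u v = (\<Sum>i<length as. 2 * as ! i * u i * v i)"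
  by (simp add: polar_def qdiag_def sum_subtractf[symmetric] power2_eq_square algebra_simps)

lemma nondegenerate_qdiag:
  fixes as :: "'k::field list"
  assumes two: "(2::'k) \<noteq> 0" and as: "0 \<notin> set as"
  shows "nondegenerate (qdiag as)"
  unfolding nondegenerate_def
proof (intro ballI impI ext)
  fix u i
  assume u: "u \<in> qcarrier (qdiag as)" and orth: "\<forall>v\<in>qcarrier (qdiag as). polar (qdiag as) u v = 0"
  show "u i = (0 :: nat \<Rightarrow> 'k) i"
  proof (cases "i < length as")
    case True
    let ?e = "\<lambda>j. if j = i then 1 else (0::'k)"
    have "?e \<in> qcarrier (qdiag as)"
      using True by (auto simp: qdiag_def)
    then have "polar (qdiag as) u ?e = 0" using orth by blast
    moreover have "polar (qdiag as) u ?e = 2 * as ! i * u i"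
      using True by (simp add: polar_qdiag if_distrib sum.delta cong: if_cong)
    moreover have "as ! i \<noteq> 0" using True as by (metis nth_mem)
    ultimately show ?thesis using two by simp
  qed (use u in \<open>simp add: qdiag_def\<close>)
qed

lemma qform_qdiag_Cons:
  "qform (qdiag (a # as)) x = a * (x 0)\<^sup>2 + qform (qdiag as) (\<lambda>j. x (Suc j))"
  unfolding qdiag_def by (simp only: length_Cons quad_space.simps sum.lessThan_Suc_shift) simp

lemma qcarrier_qdiag_Cons:
  "x \<in> qcarrier (qdiag (a # as)) \<longleftrightarrow> (\<lambda>j. x (Suc j)) \<in> qcarrier (qdiag as)"
  by (auto simp: qdiag_def) (metis Suc_le_D Suc_le_mono)

lemma qscale_qdiag: "qscale (qdiag as) c x = (\<lambda>j. c * x j)"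
  by (simp add: qdiag_def)

lemma qsum_simps:
  "(x, y) \<in> qcarrier (X \<oplus>\<^sub>q Y) \<longleftrightarrow> x \<in> qcarrier X \<and> y \<in> qcarrier Y"
  "qform (X \<oplus>\<^sub>q Y) (x, y) = qform X x + qform Y y"
  "qscale (X \<oplus>\<^sub>q Y) c (x, y) = (qscale X c x, qscale Y c y)"
  by (simp_all add: qsum_def)

section \<open>Zero summands and hyperbolic planes\<close>

text \<open>
  The new null vector is sent to the isotropic vector \<open>(1, i)\<close> of the plane \<open>diag(1,1)\<close>.
\<close>

lemma qembedded_zero_plus_plane:
  fixes S :: "('k::field, 's::ab_group_add) quad_space" and i :: 'k
  assumes i: "i\<^sup>2 = - 1" and "qembedded (qdiag zs \<oplus>\<^sub>q S) (qdiag as)"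
  shows "qembedded (qdiag (0 # zs) \<oplus>\<^sub>q S) (qdiag (1 # 1 # as))"
proof -
  obtain f where f: "isometric_embedding (qdiag zs \<oplus>\<^sub>q S) (qdiag as) f"
    using assms by (auto simp: qembedded_iff_isometric_embedding)
  define F where
    "F = (\<lambda>(x, s). case_nat (x 0) (case_nat (i * x 0) (f (\<lambda>j. x (Suc j), s))))"
  have F: "F z 0 = fst z 0" "F z (Suc 0) = i * fst z 0"
      "(\<lambda>j. F z (Suc (Suc j))) = f (\<lambda>j. fst z (Suc j), snd z)" for z
    by (auto simp: F_def case_prod_beta)
  have F_tail: "F z (Suc (Suc j)) = f (\<lambda>j. fst z (Suc j), snd z) j" for z j
    by (simp add: F_def case_prod_beta)
  have tail: "(\<lambda>j. fst z (Suc j), snd z) \<in> qcarrier (qdiag zs \<oplus>\<^sub>q S)"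
    if "z \<in> qcarrier (qdiag (0 # zs) \<oplus>\<^sub>q S)" for z
    using that by (cases z) (simp add: qsum_simps qcarrier_qdiag_Cons)
  have eqI: "x = y" if "x 0 = y 0" "x (Suc 0) = y (Suc 0)"
    "(\<lambda>j. x (Suc (Suc j))) = (\<lambda>j. y (Suc (Suc j)))" for x y :: "nat \<Rightarrow> 'k"
  proof
    fix j show "x j = y j"
      using that by (cases j; cases "j - 1") (auto simp: fun_eq_iff)
  qed
  have fC: "f z \<in> qcarrier (qdiag as)" if "z \<in> qcarrier (qdiag zs \<oplus>\<^sub>q S)" for z
    using f that unfolding isometric_embedding_def qlinear_def by blast
  have fadd: "f (u + v) = f u + f v"
    if "u \<in> qcarrier (qdiag zs \<oplus>\<^sub>q S)" "v \<in> qcarrier (qdiag zs \<oplus>\<^sub>q S)" for u v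
    using f that unfolding isometric_embedding_def qlinear_def by blast
  have fscale: "f (qscale (qdiag zs \<oplus>\<^sub>q S) c u) = qscale (qdiag as) c (f u)"
    if "u \<in> qcarrier (qdiag zs \<oplus>\<^sub>q S)" for c u
    using f that unfolding isometric_embedding_def qlinear_def by blast
  have "qlinear (qdiag (0 # zs) \<oplus>\<^sub>q S) (qdiag (1 # 1 # as)) F"
    unfolding qlinear_def
  proof (intro conjI ballI allI)
    show "F ` qcarrier (qdiag (0 # zs) \<oplus>\<^sub>q S) \<subseteq> qcarrier (qdiag (1 # 1 # as))"
      using tail fC by (auto simp: qcarrier_qdiag_Cons F)
  next
    fix u v assume uv: "u \<in> qcarrier (qdiag (0 # zs) \<oplus>\<^sub>q S)" "v \<in> qcarrier (qdiag (0 # zs) \<oplus>\<^sub>q S)"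
    show "F (u + v) = F u + F v"
    proof (rule eqI)
      show "(\<lambda>j. F (u + v) (Suc (Suc j))) = (\<lambda>j. (F u + F v) (Suc (Suc j)))"
        using fadd[OF tail tail, OF uv]
        by (simp add: F_tail plus_prod_def plus_fun_def fun_eq_iff)
    qed (simp_all add: F(1,2) algebra_simps)
  next
    fix c u assume u: "u \<in> qcarrier (qdiag (0 # zs) \<oplus>\<^sub>q S)"
    show "F (qscale (qdiag (0 # zs) \<oplus>\<^sub>q S) c u) = qscale (qdiag (1 # 1 # as)) c (F u)"
    proof (rule eqI)
      show "(\<lambda>j. F (qscale (qdiag (0 # zs) \<oplus>\<^sub>q S) c u) (Suc (Suc j))) =
          (\<lambda>j. qscale (qdiag (1 # 1 # as)) c (F u) (Suc (Suc j)))"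
        using fscale[OF tail[OF u], of c]
        by (cases u) (simp add: F_tail qsum_simps qscale_qdiag fun_eq_iff)
    qed (cases u; simp add: F(1,2) qsum_simps qscale_qdiag)+
  qed
  moreover have "inj_on F (qcarrier (qdiag (0 # zs) \<oplus>\<^sub>q S))"
  proof (rule inj_onI)
    fix u v assume uv: "u \<in> qcarrier (qdiag (0 # zs) \<oplus>\<^sub>q S)" "v \<in> qcarrier (qdiag (0 # zs) \<oplus>\<^sub>q S)"
      and eq: "F u = F v"
    have "f (\<lambda>j. fst u (Suc j), snd u) = f (\<lambda>j. fst v (Suc j), snd v)"
      using eq F(3)[of u] F(3)[of v] by metis
    then have "(\<lambda>j. fst u (Suc j), snd u) = (\<lambda>j. fst v (Suc j), snd v)"
      using f tail uv unfolding isometric_embedding_def inj_on_def by blast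
    moreover have "fst u 0 = fst v 0" using F(1) eq by metis
    ultimately have "fst u j = fst v j" for j
      by (cases j) (auto simp: fun_eq_iff)
    then show "u = v"
      using \<open>(\<lambda>j. fst u (Suc j), snd u) = _\<close> by (auto simp: prod_eq_iff fun_eq_iff)
  qed
  moreover have "qform (qdiag (1 # 1 # as)) (F z) = qform (qdiag (0 # zs) \<oplus>\<^sub>q S) z"
    if z: "z \<in> qcarrier (qdiag (0 # zs) \<oplus>\<^sub>q S)" for z
  proof -
    have "qform (qdiag as) (f (\<lambda>j. fst z (Suc j), snd z)) =
        qform (qdiag zs \<oplus>\<^sub>q S) (\<lambda>j. fst z (Suc j), snd z)"
      using f tail[OF z] unfolding isometric_embedding_def by blast
    then show ?thesis
      by (cases z) (simp add: qform_qdiag_Cons F qsum_simps power_mult_distrib i)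
  qed
  ultimately show ?thesis
    unfolding qembedded_def by blast
qed

text \<open>
  After moving the image of the null vector to \<open>e = (1, i, 0, \<dots>)\<close> by an isometry \<open>\<sigma>\<close>, the rest of
  the space is mapped into the orthogonal complement of \<open>e\<close>.  There the first two coordinates
  \<open>(- i t, t)\<close> contribute nothing to the form, and dropping them loses only multiples of \<open>e\<close>.
\<close>

lemma qembedded_cancel_plane:
  fixes S :: "('k::field, 's::ab_group_add) quad_space" and i :: 'k
  assumes two: "(2::'k) \<noteq> 0" and i: "i\<^sup>2 = - 1" and as: "0 \<notin> set as" and S: "quadratic_space S"
    and emb: "qembedded (qdiag (0 # zs) \<oplus>\<^sub>q S) (qdiag (1 # 1 # as))"
  shows "qembedded (qdiag zs \<oplus>\<^sub>q S) (qdiag as)"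
proof -
  let ?V = "qdiag (1 # 1 # as)" and ?Y = "qdiag (0 # zs) \<oplus>\<^sub>q S" and ?Z = "qdiag zs \<oplus>\<^sub>q S"
  have Z: "quadratic_space ?Z" and Y: "quadratic_space ?Y" and V: "quadratic_space ?V"
    using S by (simp_all add: quadratic_space_qsum quadratic_space_qdiag)
  have V_nd: "nondegenerate ?V"
    using two as by (intro nondegenerate_qdiag) auto
  \<comment> \<open>\<open>inc a z\<close> is \<open>z\<close> plus \<open>a\<close> times the null vector \<open>inc 1 0\<close>, so its form does not depend on \<open>a\<close>\<close>
  define inc :: "'k \<Rightarrow> (nat \<Rightarrow> 'k) \<times> 's \<Rightarrow> (nat \<Rightarrow> 'k) \<times> 's"
    where "inc a z = (case_nat a (fst z), snd z)" for a z
  have inc_carrier: "inc a z \<in> qcarrier ?Y" if "z \<in> qcarrier ?Z" for a z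
    using that by (cases z) (simp add: inc_def qsum_simps qcarrier_qdiag_Cons)
  have inc_form: "qform ?Y (inc a z) = qform ?Z z" for a z
    by (cases z) (simp add: inc_def qsum_simps qform_qdiag_Cons)
  have inc_add: "inc a z + inc b z' = inc (a + b) (z + z')" for a b z z'
    by (auto simp: inc_def fun_eq_iff split: nat.split)
  have inc_scale: "qscale ?Y c (inc a z) = inc (c * a) (qscale ?Z c z)" for a c z
    by (cases z) (auto simp: inc_def qsum_simps qscale_qdiag fun_eq_iff split: nat.split)
  have inc_inj: "z = z'" if "inc a z = inc b z'" for a b z z'
    using that by (auto simp: inc_def prod_eq_iff fun_eq_iff split: nat.splits)
  have Y0: "inc 0 0 = 0"
    by (auto simp: inc_def prod_eq_iff fun_eq_iff split: nat.split)
  have "inc 1 0 \<noteq> inc 0 0"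
    by (auto simp: inc_def fun_eq_iff split: nat.splits)
  obtain f where f: "isometric_embedding ?Y ?V f"
    using emb by (auto simp: qembedded_iff_isometric_embedding)
  have inc10: "inc 1 0 \<in> qcarrier ?Y"
    using inc_carrier qcarrier_zero[OF Z] by blast
  have "f (inc 1 0) \<noteq> f 0"
    using f \<open>inc 1 0 \<noteq> inc 0 0\<close> inc10 qcarrier_zero[OF Y]
    unfolding isometric_embedding_def inj_on_def Y0 by blast
  then have "f (inc 1 0) \<noteq> 0"
    using isometric_embedding_zero[OF Y f] by simp
  moreover have "f (inc 1 0) \<in> qcarrier ?V"
    using f inc10 unfolding isometric_embedding_def qlinear_def by blast
  moreover have "qform ?V (f (inc 1 0)) = 0"
    using f inc10 inc_form qform_zero[OF Z] unfolding isometric_embedding_def by metis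
  moreover define e :: "nat \<Rightarrow> 'k" where "e = case_nat 1 (case_nat i (\<lambda>_. 0))"
  have "e \<in> qcarrier ?V"
    by (simp add: e_def qcarrier_qdiag_Cons) (simp add: qdiag_def)
  moreover have "e \<noteq> 0"
    by (auto simp: e_def fun_eq_iff split: nat.splits)
  moreover have "qform ?V e = 0"
    using i by (simp add: e_def qform_qdiag_Cons) (simp add: qdiag_def)
  ultimately obtain \<sigma> where \<sigma>: "isometric_embedding ?V ?V \<sigma>" "\<sigma> (f (inc 1 0)) = e"
    using isometries_transitive_on_isotropic[OF V V_nd] by blast
  define h where "h = \<sigma> \<circ> f"
  have h: "isometric_embedding ?Y ?V h"
    unfolding h_def by (rule isometric_embedding_comp[OF f \<sigma>(1)])
  have h_add: "h (u + v) = h u + h v" if "u \<in> qcarrier ?Y" "v \<in> qcarrier ?Y" for u v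
    using h that unfolding isometric_embedding_def qlinear_def by blast
  have h_scale: "h (qscale ?Y c u) = qscale ?V c (h u)" if "u \<in> qcarrier ?Y" for c u
    using h that unfolding isometric_embedding_def qlinear_def by blast
  have h_form: "qform ?V (h u) = qform ?Y u" if "u \<in> qcarrier ?Y" for u
    using h that unfolding isometric_embedding_def by blast
  have h_inc: "h (inc t z) = h (inc 0 z) + qscale ?V t e" if z: "z \<in> qcarrier ?Z" for t z
  proof -
    have "qscale ?Z t 0 = 0"
    proof -
      interpret vector_space "qscale ?Z" using Z by (simp add: quadratic_space_def)
      show ?thesis by simp
    qed
    then have "inc t z = inc 0 z + qscale ?Y t (inc 1 0)"
      by (simp add: inc_scale inc_add)
    then show ?thesis
      using h_add[OF inc_carrier[OF z] qcarrier_scale[OF Y inc10]] h_scale[OF inc10] \<sigma>(2)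
      by (simp add: h_def)
  qed
  have orth: "h (inc 0 z) 0 = - i * h (inc 0 z) 1" if z: "z \<in> qcarrier ?Z" for z
  proof -
    \<comment> \<open>adding the null vector to \<open>inc 0 z\<close> keeps its form, so adding \<open>e\<close> to its image does too\<close>
    have "qform ?V (h (inc 0 z) + e) = qform ?V (h (inc 0 z))"
    proof -
      have "h (inc 1 z) = h (inc 0 z) + e"
        using h_inc[OF z, of 1] by (simp add: qscale_qdiag)
      then show ?thesis
        using h_form[OF inc_carrier[OF z]] inc_form by metis
    qed
    then have "polar ?V (h (inc 0 z)) e = 0"
      using \<open>qform ?V e = 0\<close> by (simp add: polar_def)
    then have "2 * (h (inc 0 z) 0 + i * h (inc 0 z) 1) = 0"
      unfolding polar_qdiag
      by (simp add: sum.lessThan_Suc_shift e_def algebra_simps del: sum.lessThan_Suc)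
    then have "h (inc 0 z) 0 + i * h (inc 0 z) 1 = 0"
      using two by (metis mult_eq_0_iff)
    then show ?thesis by (simp add: add_eq_0_iff2)
  qed
  define g where "g z = (\<lambda>j. h (inc 0 z) (Suc (Suc j)))" for z
  have "qlinear ?Z (qdiag as) g"
    unfolding qlinear_def
  proof (intro conjI ballI allI)
    have "h (inc 0 z) \<in> qcarrier ?V" if "z \<in> qcarrier ?Z" for z
      using h inc_carrier[OF that] unfolding isometric_embedding_def qlinear_def by blast
    then show "g ` qcarrier ?Z \<subseteq> qcarrier (qdiag as)"
      by (auto simp: g_def qcarrier_qdiag_Cons)
  next
    fix u v assume "u \<in> qcarrier ?Z" "v \<in> qcarrier ?Z"
    then show "g (u + v) = g u + g v"
      using h_add[OF inc_carrier inc_carrier, of u v 0 0] by (simp add: g_def inc_add fun_eq_iff)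
  next
    fix c u assume "u \<in> qcarrier ?Z"
    then show "g (qscale ?Z c u) = qscale (qdiag as) c (g u)"
      using h_scale[OF inc_carrier, of u c 0] by (simp add: g_def inc_scale qscale_qdiag)
  qed
  moreover have "qform (qdiag as) (g z) = qform ?Z z" if z: "z \<in> qcarrier ?Z" for z
  proof -
    have "qform ?Z z = qform ?V (h (inc 0 z))"
      using h_form[OF inc_carrier[OF z]] inc_form by simp
    also have "\<dots> = qform (qdiag as) (g z)"
      using orth[OF z] i by (simp add: qform_qdiag_Cons g_def power_mult_distrib)
    finally show ?thesis ..
  qed
  moreover have "inj_on g (qcarrier ?Z)"
  proof (rule inj_onI)
    fix z z' assume z: "z \<in> qcarrier ?Z" and z': "z' \<in> qcarrier ?Z" and eq: "g z = g z'"
    \<comment> \<open>images that agree after dropping two coordinates differ by \<open>t e\<close>, the image of \<open>t\<close> times the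
      null vector\<close>
    define t where "t = h (inc 0 z) 0 - h (inc 0 z') 0"
    have t: "t * i = h (inc 0 z) 1 - h (inc 0 z') 1"
    proof -
      have "t * i = - (i\<^sup>2) * (h (inc 0 z) 1 - h (inc 0 z') 1)"
        by (simp add: t_def orth[OF z] orth[OF z'] algebra_simps power2_eq_square)
      then show ?thesis by (simp add: i)
    qed
    have "h (inc 0 z) j = (h (inc 0 z') + qscale ?V t e) j" for j
    proof (cases j)
      case 0
      then show ?thesis by (simp add: qscale_qdiag e_def t_def)
    next
      case (Suc j')
      then show ?thesis
        using t fun_cong[OF eq, of "j' - 1"]
        by (cases j') (simp_all add: qscale_qdiag e_def g_def)
    qed
    then have "h (inc 0 z) = h (inc t z')"
      by (simp add: h_inc[OF z', of t] fun_eq_iff)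
    then have "inc 0 z = inc t z'"
      using h inc_carrier z z' unfolding isometric_embedding_def inj_on_def by blast
    then show "z = z'" by (rule inc_inj)
  qed
  ultimately show ?thesis
    unfolding qembedded_def by blast
qed

lemma qembedded_qdiag_Nil_sum_iff:
  fixes S :: "('k::field, 's::ab_group_add) quad_space"
    and X :: "('k, 'w::ab_group_add) quad_space"
  shows "qembedded (qdiag [] \<oplus>\<^sub>q S) X \<longleftrightarrow> qembedded S X"
proof -
  have Nil: "x = 0" if "x \<in> qcarrier (qdiag [])" for x :: "nat \<Rightarrow> 'k"
    using that by (auto simp: qdiag_def fun_eq_iff)
  have z: "0 \<in> qcarrier (qdiag [])" "qform (qdiag []) (x :: nat \<Rightarrow> 'k) = 0" for x
    by (auto simp: qdiag_def)
  have incl: "qembedded S (qdiag [] \<oplus>\<^sub>q S)"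
    unfolding qembedded_def qlinear_def
    by (intro exI[of _ "Pair 0"]) (auto simp: qsum_simps z qscale_qdiag inj_on_def fun_eq_iff)
  have proj: "qembedded (qdiag [] \<oplus>\<^sub>q S) S"
    unfolding qembedded_def qlinear_def
    by (intro exI[of _ snd]) (auto simp: qsum_simps z inj_on_def dest!: Nil)
  show ?thesis
    using qembedded_trans[OF incl] qembedded_trans[OF proj] by (rule iffI)
qed

text \<open>
  A nonzero isotropic vector of \<open>diag(1, l)\<close> makes \<open>- l\<close>, hence also \<open>l = i\<^sup>2 (- l)\<close>, a square.
\<close>

lemma anisotropic_qdiag:
  fixes l i :: "'k::field"
  assumes "i\<^sup>2 = - 1" "\<not> is_square l" "m < 2"
    and "x \<in> qcarrier (qdiag (replicate m 1 @ [l]))" "qform (qdiag (replicate m 1 @ [l])) x = 0"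
  shows "x = 0"
proof -
  have l: "l \<noteq> 0" using assms(2) by (auto simp: is_nth_power_def)
  have Nil: "x j = 0" if "x \<in> qcarrier (qdiag [])" for x :: "nat \<Rightarrow> 'k" and j
    using that by (simp add: qdiag_def)
  have [simp]: "qform (qdiag []) x = 0" for x :: "nat \<Rightarrow> 'k" by (simp add: qdiag_def)
  consider "m = 0" | "m = 1" using assms(3) by linarith
  then show ?thesis
  proof cases
    case 1
    have "x j = 0" for j
      using assms(4,5) Nil[of "\<lambda>j. x (Suc j)" "j - 1"] l 1
      by (cases j) (simp_all add: qform_qdiag_Cons qcarrier_qdiag_Cons)
    then show ?thesis by (simp add: fun_eq_iff)
  next
    case 2
    have q: "(x 0)\<^sup>2 + l * (x 1)\<^sup>2 = 0"
      using assms(5) 2 by (simp add: qform_qdiag_Cons)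
    have "x 1 = 0"
    proof (rule ccontr)
      assume "x 1 \<noteq> 0"
      then have "l = (i * x 0 / x 1)\<^sup>2"
        using q assms(1) by (simp add: power_mult_distrib power_divide field_simps add_eq_0_iff)
      then show False using assms(2) by (auto simp: is_nth_power_def)
    qed
    then have "x j = 0" for j
      using assms(4) q Nil[of "\<lambda>j. x (Suc (Suc j))" "j - 2"] 2
      by (cases j; cases "j - 1") (simp_all add: qcarrier_qdiag_Cons)
    then show ?thesis by (simp add: fun_eq_iff)
  qed
qed

lemma not_qembedded_anisotropic:
  fixes S :: "('k::field, 's::ab_group_add) quad_space"
  assumes S: "quadratic_space S"
    and aniso: "\<And>x. x \<in> qcarrier X \<Longrightarrow> qform X x = 0 \<Longrightarrow> x = 0"
  shows "\<not> qembedded (qdiag (0 # zs) \<oplus>\<^sub>q S) X"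
proof
  let ?Y = "qdiag (0 # zs) \<oplus>\<^sub>q S"
  assume "qembedded ?Y X"
  then obtain f where f: "isometric_embedding ?Y X f"
    by (auto simp: qembedded_iff_isometric_embedding)
  have Y: "quadratic_space ?Y"
    using S by (simp add: quadratic_space_qsum quadratic_space_qdiag)
  define v :: "(nat \<Rightarrow> 'k) \<times> 's" where "v = (case_nat 1 (\<lambda>_. 0), 0)"
  have v: "v \<in> qcarrier ?Y"
    using qcarrier_zero[OF S] by (simp add: v_def qsum_simps qcarrier_qdiag_Cons) (simp add: qdiag_def)
  have "qform ?Y v = 0"
    using qform_zero[OF S] by (simp add: v_def qsum_simps qform_qdiag_Cons) (simp add: qdiag_def)
  then have "f v = 0"
    using aniso f v unfolding isometric_embedding_def qlinear_def by (metis image_subset_iff)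
  then have "v = 0"
    using f v qcarrier_zero[OF Y] isometric_embedding_zero[OF Y f]
    unfolding isometric_embedding_def inj_on_def by metis
  then show False
    by (auto simp: v_def prod_eq_iff fun_eq_iff split: nat.splits)
qed

text \<open>
  Induction on the number of zeros, cancelling one zero against one plane \<open>diag(1,1)\<close>.  When fewer
  than two entries \<open>1\<close> remain, the target is anisotropic, and a zero entry cannot be embedded.
\<close>

theorem qembedded_zeros_plus_iff:
  fixes S :: "('k::field, 's::ab_group_add) quad_space" and i l :: 'k
  assumes two: "(2::'k) \<noteq> 0" and i: "i\<^sup>2 = - 1" and l: "\<not> is_square l" and S: "quadratic_space S"
  shows "qembedded (qdiag (replicate k 0) \<oplus>\<^sub>q S) (qdiag (replicate m 1 @ [l])) \<longleftrightarrow>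
    2 * k \<le> m \<and> qembedded S (qdiag (replicate (m - 2 * k) 1 @ [l]))"
proof (induction k arbitrary: m)
  case 0
  show ?case by (simp add: qembedded_qdiag_Nil_sum_iff)
next
  case (Suc k)
  show ?case
  proof (cases "m < 2")
    case True
    then show ?thesis
      using not_qembedded_anisotropic[OF S anisotropic_qdiag[OF i l]] by simp
  next
    case False
    then obtain m' where m: "m = Suc (Suc m')"
      by (metis not_less_eq not_less_zero numeral_2_eq_2 not0_implies_Suc)
    have "0 \<notin> set (replicate m' 1 @ [l])"
      using l by (auto simp: is_nth_power_def)
    then have "qembedded (qdiag (replicate (Suc k) 0) \<oplus>\<^sub>q S) (qdiag (replicate m 1 @ [l])) \<longleftrightarrow>
        qembedded (qdiag (replicate k 0) \<oplus>\<^sub>q S) (qdiag (replicate m' 1 @ [l]))"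
      using qembedded_cancel_plane[OF two i _ S] qembedded_zero_plus_plane[OF i] m by auto
    then show ?thesis by (simp add: Suc.IH m)
  qed
qed

section \<open>Squares in the p-adic numbers\<close>

lemma of_int_mod_ring_eq_iff_cong:
  "(of_int a :: 'p::prime_card mod_ring) = of_int b \<longleftrightarrow> [a = b] (mod int CARD('p))"
  unfolding of_int_of_int_mod_ring cong_def by transfer simp

lemma prime_int_CARD: "prime (int CARD('p::prime_card))"
  using prime_card[where 'a = 'p] by simp

lemma padic_reduce_eq_of_int:
  assumes "1 \<le> n"
  shows "padic_reduce (x :: 'p::prime_card padic_int) = of_int (padic_component x n)"
proof -
  have "[padic_component x n = padic_component x 1] (mod int CARD('p))"
    using padic_component_mod_le[OF assms, of x] padic_component_mod[of x 1]
    by (simp add: cong_def)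
  then show ?thesis
    by (simp add: padic_reduce_def of_int_mod_ring_eq_iff_cong cong_sym_eq flip: of_int_of_int_mod_ring)
qed

lemma of_int_eq_0_mod_ring: "(of_int a :: 'p::prime_card mod_ring) = 0 \<longleftrightarrow> int CARD('p) dvd a"
  using of_int_mod_ring_eq_iff_cong[of a 0, where 'p = 'p] by (simp add: cong_0_iff)

lemma CARD_not_dvd_2:
  assumes "CARD('p::prime_card) \<noteq> 2"
  shows "\<not> int CARD('p) dvd 2"
  using assms prime_ge_2_nat[OF prime_card[where 'a = 'p]] by (auto dest: zdvd_imp_le)

lemma padic_reduce_0: "padic_reduce (0 :: 'p::prime_card padic_int) = 0"
  by (simp add: padic_reduce_def padic_component_zero)

text \<open>
  Hensel's lemma for \<open>X\<^sup>2 - a\<close>.  The iteration is Newton's with the derivative frozen: the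
  correction is multiplied by a fixed inverse \<open>c\<close> of \<open>2 x\<^sub>0\<close> modulo \<open>p\<close>, which still gains one power
  of \<open>p\<close> per step.  That inverse exists because \<open>p\<close> is odd and the residue of \<open>a\<close> is nonzero.
\<close>

lemma is_square_padic_int_if_residue:
  fixes a :: "'p::prime_card padic_int"
  assumes odd: "CARD('p) \<noteq> 2" and nz: "padic_reduce a \<noteq> 0" and sq: "is_square (padic_reduce a)"
  shows "is_square a"
proof -
  define P where "P = int CARD('p)"
  have P: "prime P" unfolding P_def by (rule prime_int_CARD)
  obtain y where y: "padic_reduce a = y\<^sup>2" using sq by (auto simp: is_nth_power_def)
  obtain x0 where x0: "y = of_int x0"
    by (metis of_int_mod_ring_to_int_mod_ring of_int_of_int_mod_ring)
  have A1: "P dvd x0\<^sup>2 - padic_component a 1"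
    using y x0 of_int_mod_ring_eq_iff_cong[of "x0\<^sup>2" "padic_component a 1", where 'p = 'p]
    by (simp add: padic_reduce_eq_of_int[of 1] P_def cong_iff_dvd_diff)
  have "\<not> P dvd x0"
    using nz y x0 by (simp add: P_def flip: of_int_eq_0_mod_ring)
  moreover have "\<not> P dvd 2"
    unfolding P_def by (rule CARD_not_dvd_2[OF odd])
  ultimately have "coprime (2 * x0) P"
    using P by (metis coprime_commute prime_imp_coprime prime_dvd_mult_iff)
  then obtain c where "[2 * x0 * c = 1] (mod P)"
    using cong_solve_coprime_int by blast
  then have c: "P dvd 2 * x0 * c - 1" by (simp add: cong_iff_dvd_diff)
  \<comment> \<open>the \<open>n\<close>-th approximation solves the equation modulo \<open>P ^ (n + 1)\<close>; the correction uses
    component \<open>n + 2\<close> of \<open>a\<close>, the modulus that the next approximation has to reach\<close>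
  define s where "s = rec_nat x0 (\<lambda>n x. x - c * (x\<^sup>2 - padic_component a (n + 2)))"
  have s0: "s 0 = x0" and sS: "s (Suc n) = s n - c * ((s n)\<^sup>2 - padic_component a (n + 2))" for n
    by (simp_all add: s_def)
  have coh: "P ^ m dvd padic_component a n - padic_component a m" if "m \<le> n" for m n
    using padic_component_mod_le[OF that, of a] padic_component_mod[of a m]
    by (metis P_def mod_eq_dvd_iff)
  have s: "P ^ Suc n dvd (s n)\<^sup>2 - padic_component a (Suc n) \<and> P dvd s n - x0" for n
  proof (induction n)
    case 0
    then show ?case using A1 by (simp add: s0)
  next
    case (Suc n)
    define d where "d = (s n)\<^sup>2 - padic_component a (n + 2)"
    have d: "P ^ Suc n dvd d"
      using dvd_diff[OF conjunct1[OF Suc.IH] coh[of "Suc n" "n + 2"]] by (simp add: d_def)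
    then have "P dvd d" by (meson dvd_power_same dvd_trans dvd_power zero_less_Suc)
    have "P dvd 2 * (s n - x0) * c + (2 * x0 * c - 1)"
      using Suc.IH c by (intro dvd_add dvd_mult2 dvd_mult) auto
    then have "P dvd c\<^sup>2 * d - (2 * (s n - x0) * c + (2 * x0 * c - 1))"
      using \<open>P dvd d\<close> by simp
    then have "P ^ Suc n * P dvd d * (c\<^sup>2 * d - (2 * (s n - x0) * c + (2 * x0 * c - 1)))"
      using d by (rule mult_dvd_mono[rotated])
    moreover have "d * (c\<^sup>2 * d - (2 * (s n - x0) * c + (2 * x0 * c - 1)))
        = (s (Suc n))\<^sup>2 - padic_component a (Suc (Suc n))"
      unfolding sS d_def by (simp add: algebra_simps power2_eq_square)
    moreover have "P dvd s (Suc n) - x0"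
    proof -
      have "s (Suc n) - x0 = (s n - x0) - c * d" by (simp add: sS d_def)
      then show ?thesis using Suc.IH \<open>P dvd d\<close> by (simp only: dvd_diff dvd_mult)
    qed
    ultimately show ?case by (simp add: mult.commute)
  qed
  have step: "[s (Suc n) = s n] (mod P ^ n)" for n
  proof -
    have "P ^ Suc n dvd (s n)\<^sup>2 - padic_component a (n + 2)"
      using dvd_diff[OF conjunct1[OF s[of n]] coh[of "Suc n" "n + 2"]] by simp
    then have "P ^ n dvd (s n)\<^sup>2 - padic_component a (n + 2)"
      by (rule dvd_trans[rotated]) (simp add: le_imp_power_dvd)
    then show ?thesis by (simp add: sS cong_iff_dvd_diff)
  qed
  define x :: "'p padic_int" where "x = Abs_padic_int (\<lambda>n. s n mod P ^ n)"
  have x: "padic_component x n = s n mod P ^ n" for n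
    using padic_lift_aux[where 'p = 'p, of s] step unfolding x_def P_def
    by (subst Abs_padic_int_inverse) auto
  have "padic_component (x\<^sup>2) n = padic_component a n" for n
  proof -
    have "P ^ n dvd ((s n)\<^sup>2 - padic_component a (Suc n)) + (padic_component a (Suc n) - padic_component a n)"
      using s[of n] coh[of n "Suc n"] by (intro dvd_add) (auto intro: dvd_trans[OF le_imp_power_dvd])
    then have "(s n)\<^sup>2 mod P ^ n = padic_component a n mod P ^ n"
      by (simp add: mod_eq_dvd_iff)
    then show ?thesis
      using padic_component_mod[of a n]
      by (simp add: power2_eq_square padic_component_mult x P_def mod_simps)
  qed
  then have "x\<^sup>2 = a" by (simp add: padic_component_inject[symmetric] fun_eq_iff)
  then show ?thesis by (auto simp: is_nth_power_def)
qed

lemma is_square_minus_one_mod_ring: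
  assumes "[CARD('p::prime_card) = 1] (mod 4)"
  shows "is_square (- 1 :: 'p mod_ring)"
proof -
  let ?p = "CARD('p)"
  have p: "prime ?p" by (rule prime_card)
  have m: "?p mod 4 = 1" using assms by (simp add: cong_def)
  then have p2: "?p > 2"
    using prime_ge_2_nat[OF p] by (cases "?p = 2") auto
  have "even ((?p - 1) div 2)" using m by presburger
  then have "[Legendre (- 1) (int ?p) = 1] (mod int ?p)"
    using euler_criterion[OF p p2, of "- 1"] by simp
  moreover have "\<not> [- 1 = 1] (mod int ?p)" "\<not> [0 = 1] (mod int ?p)"
    using p2 by (auto simp: cong_iff_dvd_diff dest!: zdvd_imp_le)
  ultimately have "QuadRes (int ?p) (- 1)"
    by (auto simp: Legendre_def split: if_splits)
  then obtain y where "[y\<^sup>2 = - 1] (mod int ?p)" by (auto simp: QuadRes_def)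
  then have "(of_int (y\<^sup>2) :: 'p mod_ring) = of_int (- 1)"
    unfolding of_int_mod_ring_eq_iff_cong .
  then have "- 1 = (of_int y :: 'p mod_ring)\<^sup>2" by simp
  then show ?thesis unfolding is_nth_power_def by blast
qed

lemma is_square_minus_one_padic_int:
  assumes "[CARD('p::prime_card) = 1] (mod 4)"
  shows "is_square (- 1 :: 'p padic_int)"
proof (rule is_square_padic_int_if_residue)
  have *: "padic_reduce (- 1 :: 'p padic_int) = - 1"
    using padic_reduce_add[of "- 1" "1 :: 'p padic_int"]
    by (simp add: padic_reduce_0 padic_reduce_1 eq_neg_iff_add_eq_0)
  show "padic_reduce (- 1 :: 'p padic_int) \<noteq> 0" by (simp add: *)
  show "is_square (padic_reduce (- 1 :: 'p padic_int))"
    unfolding * by (rule is_square_minus_one_mod_ring[OF assms])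
  show "CARD('p) \<noteq> 2" using assms by (auto simp: cong_def)
qed

text \<open>
  From \<open>l b\<^sup>2 = a\<^sup>2\<close> with \<open>b \<noteq> 0\<close>, one component of sufficiently high index gives a congruence between
  integers.  The power of \<open>p\<close> in \<open>b\<close> then divides \<open>a\<close> as well; dividing it out leaves a square root
  of the residue of \<open>l\<close>.
\<close>

lemma not_is_square_padic_of_int:
  fixes l :: "'p::prime_card padic_int"
  assumes "\<not> is_square (padic_reduce l)"
  shows "\<not> is_square (padic_of_int l)"
proof
  define P where "P = int CARD('p)"
  have P: "prime P" unfolding P_def by (rule prime_int_CARD)
  assume "is_square (padic_of_int l)"
  then obtain z where z: "padic_of_int l = z\<^sup>2" by (auto simp: is_nth_power_def)
  obtain a b where ab: "z = Fract a b" "b \<noteq> 0" by (cases z) auto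
  have "l * (b * b) = a * a"
    using z ab by (simp add: padic_of_int_def power2_eq_square eq_fract)
  obtain m where m: "padic_component b m \<noteq> 0"
    using ab(2) by (metis (no_types, lifting) ext padic_component_inject padic_component_zero)
  \<comment> \<open>index \<open>2 m\<close> leaves at least one factor \<open>p\<close> of the modulus: the square of the power of \<open>p\<close>
    in \<open>b\<close> is a proper divisor of \<open>p ^ (2 m)\<close>\<close>
  define A B L where "A = padic_component a (2 * m)" and "B = padic_component b (2 * m)"
    and "L = padic_component l (2 * m)"
  have "[L * (B * B) = A * A] (mod P ^ (2 * m))"
    using arg_cong[OF \<open>l * (b * b) = a * a\<close>, of "\<lambda>x. padic_component x (2 * m)"]
    by (simp add: padic_component_mult A_def B_def L_def P_def cong_def mod_simps)
  then have dvd: "P ^ (2 * m) dvd L * B\<^sup>2 - A\<^sup>2"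
    by (simp add: cong_iff_dvd_diff power2_eq_square)
  have B: "\<not> P ^ m dvd B"
    using m padic_component_eq_0_iff[of m "2 * m" b] by (simp add: B_def P_def)
  then have "B \<noteq> 0" by auto
  then obtain B' where B': "B = P ^ multiplicity P B * B'" "\<not> P dvd B'"
    using multiplicity_decompose'[of B P] P by (metis not_prime_unit)
  define j where "j = multiplicity P B"
  have Bj: "B = P ^ j * B'" using B'(1) by (simp add: j_def)
  have "j < m" using B Bj by (metis dvd_triv_left le_imp_power_dvd dvd_trans not_less)
  then have "2 * m = 2 * j + (2 * m - 2 * j)" "1 \<le> 2 * m - 2 * j" by auto
  then have Pm: "P ^ (2 * m) = P ^ (2 * j) * P ^ (2 * m - 2 * j)" by (metis power_add)
  have "P ^ (2 * j) dvd L * B\<^sup>2"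
    by (simp add: Bj power_mult_distrib mult.commute[of 2] flip: power_mult)
  moreover have "P ^ (2 * j) dvd L * B\<^sup>2 - A\<^sup>2"
    using dvd Pm by (metis dvd_mult_left)
  ultimately have "P ^ (2 * j) dvd A\<^sup>2" by (simp add: dvd_diff_right_iff)
  then have "P ^ j dvd A"
    by (metis power_mult mult.commute pos2 pow_divides_pow_iff)
  then obtain A' where A': "A = P ^ j * A'" by auto
  have "P ^ (2 * j) * P ^ (2 * m - 2 * j) dvd P ^ (2 * j) * (L * B'\<^sup>2 - A'\<^sup>2)"
    using dvd unfolding Pm Bj A' by (simp add: algebra_simps power_mult_distrib power_mult[symmetric])
  then have "P ^ (2 * m - 2 * j) dvd L * B'\<^sup>2 - A'\<^sup>2"
    using P by (subst (asm) dvd_times_left_cancel_iff) auto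
  then have "P dvd L * B'\<^sup>2 - A'\<^sup>2"
    using \<open>1 \<le> 2 * m - 2 * j\<close> by (metis dvd_power dvd_trans less_le_trans zero_less_one)
  then have "(of_int (L * B'\<^sup>2) :: 'p mod_ring) = of_int (A'\<^sup>2)"
    unfolding of_int_mod_ring_eq_iff_cong by (simp add: P_def cong_iff_dvd_diff)
  moreover have "(of_int B' :: 'p mod_ring) \<noteq> 0"
    using B'(2) by (simp add: of_int_eq_0_mod_ring P_def)
  ultimately have "of_int L = (of_int A' / of_int B' :: 'p mod_ring)\<^sup>2"
    by (simp add: power_divide field_simps)
  moreover have "padic_reduce l = of_int L"
    unfolding L_def using \<open>j < m\<close> by (intro padic_reduce_eq_of_int) auto
  ultimately show False
    using assms by (auto simp: is_nth_power_def)
qed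

lemma padic_two_neq_0:
  assumes "CARD('p::prime_card) \<noteq> 2"
  shows "(2 :: 'p padic) \<noteq> 0"
proof
  assume "(2 :: 'p padic) = 0"
  have "(1 + 1 :: 'p padic) = Fract (1 + 1) 1"
    by (simp add: One_fract_def)
  then have "(1 + 1 :: 'p padic_int) = 0"
    using \<open>(2 :: 'p padic) = 0\<close> by (simp add: Zero_fract_def eq_fract)
  then have "(of_int 2 :: 'p mod_ring) = 0"
    using padic_reduce_add[of 1 "1 :: 'p padic_int"] by (simp add: padic_reduce_0 padic_reduce_1)
  then have "int CARD('p) dvd 2" unfolding of_int_eq_0_mod_ring .
  then show False
    using CARD_not_dvd_2[OF assms] by blast
qed

lemma padic_of_int_power2: "padic_of_int (x\<^sup>2) = (padic_of_int x)\<^sup>2"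
  by (simp add: padic_of_int_def power2_eq_square)

lemma padic_of_int_minus_one: "padic_of_int (- 1) = (- 1 :: 'p::prime_card padic)"
  by (simp add: padic_of_int_def One_fract_def)

section \<open>Embeddings of degenerate spaces over the p-adic numbers\<close>

theorem theorem17:
  fixes p n k :: nat
    and lam :: "'p::prime_card padic_int"
    and A :: "('p padic, 'a::ab_group_add) quad_space"
    and S :: "('p padic, 's::ab_group_add) quad_space"
  assumes "p = CARD('p)" and "prime p" and "[p = 1] (mod 4)"
    and "lam dvd 1" and "\<not> is_square (padic_reduce lam)"
    and "quadratic_space A" and "degenerate A"
    and "quadratic_space S" and "nondegenerate S"
    and "qisometric A (qdiag (replicate k 0) \<oplus>\<^sub>q S)"
    and "n \<ge> 1"
  shows "qembedded A (qdiag (replicate (n - 1) 1 @ [padic_of_int lam])) \<longleftrightarrow>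
    (2 * k + 1 \<le> n \<and> qembedded S (qdiag (replicate (n - 2 * k - 1) 1 @ [padic_of_int lam]))) \<and>
    (even n \<longrightarrow> real k \<le> (real n - 2) / 2)"
proof -
  let ?l = "padic_of_int lam" and ?Y = "qdiag (replicate k 0) \<oplus>\<^sub>q S"
  obtain j :: "'p padic_int" where j: "j\<^sup>2 = - 1"
    using is_square_minus_one_padic_int[where 'p = 'p] assms(1,3) unfolding is_nth_power_def by metis
  have i: "(padic_of_int j)\<^sup>2 = - 1"
    using j by (simp add: padic_of_int_minus_one flip: padic_of_int_power2)
  have two: "(2 :: 'p padic) \<noteq> 0"
    using assms(1,3) by (intro padic_two_neq_0) (auto simp: cong_def)
  have to_Y: "qembedded A ?Y" and from_Y: "qembedded ?Y A"
    using assms qisometric_imp_qembedded qisometric_imp_qembedded_converse by blast+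
  have "qembedded A (qdiag (replicate (n - 1) 1 @ [?l])) \<longleftrightarrow>
      qembedded ?Y (qdiag (replicate (n - 1) 1 @ [?l]))"
    using qembedded_trans[OF from_Y] qembedded_trans[OF to_Y] by (rule iffI)
  also have "\<dots> \<longleftrightarrow> 2 * k \<le> n - 1 \<and> qembedded S (qdiag (replicate (n - 1 - 2 * k) 1 @ [?l]))"
    by (rule qembedded_zeros_plus_iff[OF two i not_is_square_padic_of_int[OF assms(5)] assms(8)])
  also have "2 * k \<le> n - 1 \<longleftrightarrow> 2 * k + 1 \<le> n \<and> (even n \<longrightarrow> real k \<le> (real n - 2) / 2)"
  proof -
    have "real k \<le> (real n - 2) / 2" if "2 * k + 1 \<le> n" "even n"
    proof -
      \<comment> \<open>an even \<open>n\<close> is not equal to \<open>2 * k + 1\<close>\<close>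
      have "2 * k + 2 \<le> n" using that by presburger
      then have "real (2 * k + 2) \<le> real n" by (simp only: of_nat_le_iff)
      then show ?thesis by simp
    qed
    then show ?thesis using assms(11) by auto
  qed
  finally show ?thesis by (simp add: diff_diff_add add.commute conj_ac)
qed

end
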